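(* Let $g(n)=1$ for all $n$, and let $f:\mathbb{Z}^+\to\mathbb{Z}^+$ satisfy $\lim_{n\to\infty}f(n)=\infty$ and $f(n)\le\frac{n}{5\log n}$ for all sufficiently large $n$. Let $M_n=M(\vec b_n(f,g))$. Then the random transposition walk on $S_{M_n}$ mixes in total variation distance in order $\frac{n+2\Delta}{f(n)}$ time; that is, there are constants $0<a<A$ such that the total variation mixing time $\tau^n_{\mathrm{mix}}$ satisfies $a\,\frac{n+2\Delta}{f(n)}\le\tau^n_{\mathrm{mix}}\le A\,\frac{n+2\Delta}{f(n)}$ for all sufficiently large $n$. Furthermore, the walk does not have total variation cutoff.
   Context: For an $n\times n$ $\{0,1\}$-matrix $M$ let $S_M=\{\sigma\in S_n : M(i,\sigma(i))=1 \text{ for all } i\}$. For $\vec b=(b_1,\dots,b_n)$ with entries in $\{1,\dots,n\}$, $M(\vec b)$ is the matrix with $M(\vec b)(i,j)=1$ iff $j\ge b_i$. The vector $\vec b_n(f,g)=(b_1,\dots,b_n)$ has $b_i=1$ for $i\le f(n)$ and $b_i=g(n)+1$ for $f(n)<i\le n$. Thus for $g(n)=1$, $S_{M_n}=\{\sigma\in S_n:\sigma(i)\ge 2\text{ for all } i>f(n)\}$. Random transposition walk on $S_M$: from $\sigma$, choose an ordered pair $(i,j)\in\{1,\dots,n\}^2$ ($i=j$ allowed) uniformly among those pairs for which the permutation obtained from $\sigma$ by exchanging the values in positions $i$ and $j$ is in $S_M$, and move to that permutation. The induced graph on $S_{M_n}$ (joining permutations differing by one such exchange with $i\ne j$) is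 regular of degree $\Delta=\sum_{i=1}^n(i-b_i)$, and $n+2\Delta=n^2-2ng(n)+2f(n)g(n)$. Hence $P(\sigma,\sigma)=\frac{n}{n+2\Delta}$, $P(\sigma,\tau)=\frac{2}{n+2\Delta}$ for adjacent $\sigma,\tau$, and the stationary distribution $\pi$ is uniform. Let $\|\mu-\nu\|_{TV}=\frac12\sum_x|\mu(x)-\nu(x)|$, $d(t)=\|P^t(x,\cdot)-\pi\|_{TV}$ (independent of $x$, as the walk is vertex transitive), $\tau^n_{\mathrm{mix}}(\epsilon)=\min\{t: d(t)\le\epsilon\}$ and $\tau^n_{\mathrm{mix}}=\tau^n_{\mathrm{mix}}(1/4)$. Total variation cutoff means $\lim_{n\to\infty}\tau^n_{\mathrm{mix}}(\epsilon)/\tau^n_{\mathrm{mix}}(1-\epsilon)=1$ for all $\epsilon\in(0,1)$. *)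

theory Defs
  imports "HOL-Probability.Probability" "HOL-Combinatorics.Permutations"
begin

text \<open>An \<open>n \<times> n\<close> \<open>{0,1}\<close>-matrix is a function \<^typ>\<open>nat \<Rightarrow> nat \<Rightarrow> nat\<close>, and a vector of length
  \<open>n\<close> a function \<^typ>\<open>nat \<Rightarrow> nat\<close>; only the values at indices in \<^term>\<open>{1..n::nat}\<close> matter.\<close>

definition restricted_perms :: "nat \<Rightarrow> (nat \<Rightarrow> nat \<Rightarrow> nat) \<Rightarrow> (nat \<Rightarrow> nat) set" where
  "restricted_perms n M = {\<sigma>. \<sigma> permutes {1..n} \<and> (\<forall>i\<in>{1..n}. M i (\<sigma> i) = 1)}"

definition one_sided_matrix :: "(nat \<Rightarrow> nat) \<Rightarrow> nat \<Rightarrow> nat \<Rightarrow> nat" where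
  "one_sided_matrix b i j = (if j \<ge> b i then 1 else 0)"

definition two_step_vec :: "(nat \<Rightarrow> nat) \<Rightarrow> (nat \<Rightarrow> nat) \<Rightarrow> nat \<Rightarrow> nat \<Rightarrow> nat" where
  "two_step_vec f g n i = (if i \<le> f n then 1 else g n + 1)"

text \<open>Degree of the transposition graph on the permutations restricted by \<open>one_sided_matrix b\<close>, for
  nondecreasing \<open>b\<close> with \<open>b i \<le> i\<close>: at the identity, exchanging positions \<open>j < i\<close> is
  admissible iff \<open>b i \<le> j\<close>. The sum is over \<open>int\<close> to avoid truncated subtraction.\<close>

definition graph_degree :: "nat \<Rightarrow> (nat \<Rightarrow> nat) \<Rightarrow> int" where
  "graph_degree n b = (\<Sum>i=1..n. int i - int (b i))"

definition admissible_pairs ::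
    "nat \<Rightarrow> (nat \<Rightarrow> nat \<Rightarrow> nat) \<Rightarrow> (nat \<Rightarrow> nat) \<Rightarrow> (nat \<times> nat) set" where
  "admissible_pairs n M \<sigma> =
     {(i, j) \<in> {1..n} \<times> {1..n}. \<sigma> \<circ> Transposition.transpose i j \<in> restricted_perms n M}"

text \<open>Only meaningful for \<open>n \<ge> 1\<close> and \<open>\<sigma>\<close> in \<^term>\<open>restricted_perms n M\<close>: then the pairs \<open>(i, i)\<close>
  are admissible, so the set of admissible pairs is finite and nonempty.\<close>

definition rt_step ::
    "nat \<Rightarrow> (nat \<Rightarrow> nat \<Rightarrow> nat) \<Rightarrow> (nat \<Rightarrow> nat) \<Rightarrow> (nat \<Rightarrow> nat) pmf" where
  "rt_step n M \<sigma> = map_pmf (\<lambda>(i, j). \<sigma> \<circ> Transposition.transpose i j) (pmf_of_set (admissible_pairs n M \<sigma>))"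

definition rt_walk ::
    "nat \<Rightarrow> (nat \<Rightarrow> nat \<Rightarrow> nat) \<Rightarrow> nat \<Rightarrow> (nat \<Rightarrow> nat) \<Rightarrow> (nat \<Rightarrow> nat) pmf" where
  "rt_walk n M t \<sigma> = ((\<lambda>\<mu>. bind_pmf \<mu> (rt_step n M)) ^^ t) (return_pmf \<sigma>)"

definition tv_dist_on :: "'a set \<Rightarrow> 'a pmf \<Rightarrow> 'a pmf \<Rightarrow> real" where
  "tv_dist_on S \<mu> \<nu> = 1/2 * (\<Sum>x\<in>S. \<bar>pmf \<mu> x - pmf \<nu> x\<bar>)"

text \<open>Distance to the stationary (uniform) distribution after \<open>t\<close> steps, from a worst starting
  point. When the walk is vertex transitive, all starting points give the same value.\<close>

definition rt_dist :: "nat \<Rightarrow> (nat \<Rightarrow> nat \<Rightarrow> nat) \<Rightarrow> nat \<Rightarrow> real" where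
  "rt_dist n M t =
     (MAX \<sigma>\<in>restricted_perms n M.
        tv_dist_on (restricted_perms n M) (rt_walk n M t \<sigma>) (pmf_of_set (restricted_perms n M)))"

definition rt_mixing_time :: "nat \<Rightarrow> (nat \<Rightarrow> nat \<Rightarrow> nat) \<Rightarrow> real \<Rightarrow> nat" where
  "rt_mixing_time n M \<epsilon> = (LEAST t. rt_dist n M t \<le> \<epsilon>)"

definition rt_tv_cutoff :: "(nat \<Rightarrow> nat \<Rightarrow> nat \<Rightarrow> nat) \<Rightarrow> bool" where
  "rt_tv_cutoff M \<longleftrightarrow>
     (\<forall>\<epsilon>\<in>{0<..<1}.
        (\<lambda>n. real (rt_mixing_time n (M n) \<epsilon>) / real (rt_mixing_time n (M n) (1 - \<epsilon>)))
          \<longlonglongrightarrow> 1)"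

end

theory Submission
  imports Defs
begin

text \<open>
  Write \<open>N = n + 2 \<Delta>\<close> and call the position of the value \<open>1\<close> the hole. The constraint says exactly
  that the hole lies in \<open>{1..f}\<close>, and the number of admissible pairs is
  \<open>N = n\<^sup>2 - 2 n + 2 f\<close> at every state. The hole is itself a Markov chain: at each step it is
  moved to any given other position of \<open>{1..f}\<close> with probability \<open>2 / N\<close>, so its deviation from
  uniformity shrinks by the factor \<open>\<beta> = 1 - 2 f / N\<close> per step, with no cutoff. The remaining values
  perform a lazy random transposition walk on the other \<open>n - 1\<close> positions, which needs time of
  order \<open>n ln n\<close>. As \<open>f \<le> n / (5 ln n)\<close>, this is at most of order \<open>N / f\<close>, the time scale of
  the hole, which therefore decides the mixing time.

  The comparison is made through cosets. For a set \<open>B\<close> of positions without the hole, start the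
  walk from the uniform law on \<open>\<sigma> Sym(B)\<close>. One step turns it into a mixture of laws of the same
  kind: a transposition \<open>(i j)\<close> applied to \<open>\<sigma> Sym(B)\<close> gives \<open>\<sigma> (i j) Sym((i j) B)\<close>, except that
  for \<open>j\<close> outside \<open>B\<close> the transpositions \<open>(j i)\<close> with \<open>i \<in> insert j B\<close> together give the uniform law
  on \<open>\<sigma> Sym(insert j B)\<close> (lemma \<open>coset_dev_Suc\<close>). This is the idea behind Broder's marking scheme for
  strong uniform times, in algebraic form. Hence \<open>B\<close> grows from size \<open>k\<close> to \<open>k + 1\<close> with probability
  \<open>(k + 1) (n - 1 - k) / N\<close>, and a potential function shows that it fills up all positions but
  the hole within order \<open>N ln n / n\<close> steps. From then on only the hole matters, and the distance is
  exactly \<open>\<beta> ^ t (1 - 1 / f)\<close> (lemma \<open>coset_dist_full\<close>). If \<open>d t\<close>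
  denotes the distance at time \<open>t\<close> from a worst starting point, then
  \<open>\<beta> ^ t (1 - 1 / f) \<le> d t\<close> and \<open>d (s + t) \<le> n\<^sup>2 (1 - n / (2 N)) ^ s + \<beta> ^ t\<close>.

  Consequently, for large \<open>n\<close>, the mixing time at every level \<open>\<epsilon> \<ge> 1/4\<close> is at most \<open>6 N / f\<close>, and at every level
  \<open>\<epsilon> > 0\<close> it is at least \<open>ln (1 / (2 \<epsilon>)) N / (4 f)\<close>. At \<open>\<epsilon> = 1/4\<close> the two bounds give the order
  \<open>N / f\<close>. For small \<open>\<epsilon>\<close> the lower bound at \<open>\<epsilon>\<close> is at least twice the upper bound at \<open>1 - \<epsilon>\<close>, which
  excludes cutoff.
\<close>

section \<open>First-step analysis of the walk\<close>

abbreviation swap :: "nat \<Rightarrow> nat \<Rightarrow> nat \<Rightarrow> nat" where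
  "swap \<equiv> Transposition.transpose"

lemma iterate_bind_pmf:
  fixes K :: "'a \<Rightarrow> 'a pmf"
  shows "((\<lambda>\<mu>. bind_pmf \<mu> K) ^^ t) \<mu> = bind_pmf \<mu> (\<lambda>x. ((\<lambda>\<mu>. bind_pmf \<mu> K) ^^ t) (return_pmf x))"
proof (induction t)
  case 0
  show ?case unfolding funpow.simps id_apply by (rule bind_return_pmf'[symmetric])
next
  case (Suc t)
  show ?case
    unfolding funpow.simps o_apply by (subst Suc) (simp add: bind_assoc_pmf)
qed

lemma rt_walk_0: "rt_walk n M 0 \<sigma> = return_pmf \<sigma>"
  by (simp add: rt_walk_def)

lemma rt_walk_Suc: "rt_walk n M (Suc t) \<sigma> = bind_pmf (rt_step n M \<sigma>) (rt_walk n M t)"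
proof -
  have "rt_walk n M (Suc t) \<sigma> = ((\<lambda>\<mu>. bind_pmf \<mu> (rt_step n M)) ^^ t) (rt_step n M \<sigma>)"
    unfolding rt_walk_def by (simp only: funpow_Suc_right o_apply bind_return_pmf)
  also have "\<dots> = bind_pmf (rt_step n M \<sigma>) (rt_walk n M t)"
    unfolding rt_walk_def by (rule iterate_bind_pmf)
  finally show ?thesis .
qed

lemma pmf_rt_walk_Suc:
  assumes "finite (admissible_pairs n M \<sigma>)" "admissible_pairs n M \<sigma> \<noteq> {}"
  shows "pmf (rt_walk n M (Suc t) \<sigma>) x
    = (\<Sum>(i, j)\<in>admissible_pairs n M \<sigma>. pmf (rt_walk n M t (\<sigma> \<circ> swap i j)) x)
        / card (admissible_pairs n M \<sigma>)"
  unfolding rt_walk_Suc rt_step_def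
  by (simp add: pmf_bind integral_pmf_of_set[OF assms(2,1)] case_prod_unfold)

section \<open>Sums over symmetric groups\<close>

lemma conj_swap_permutes:
  assumes "\<pi> permutes B"
  shows "swap i j \<circ> \<pi> \<circ> swap i j permutes swap i j ` B"
proof -
  have "bij (swap i j \<circ> \<pi> \<circ> swap i j)"
    using assms by (intro bij_comp bij_transpose permutes_bij)
  moreover have "(swap i j \<circ> \<pi> \<circ> swap i j) x = x" if "x \<notin> swap i j ` B" for x
  proof -
    have "swap i j x \<notin> B"
      using that by (metis imageI transpose_involutory)
    then show ?thesis
      using assms by (simp add: permutes_not_in)
  qed
  ultimately show ?thesis
    unfolding permutes_def by (simp add: bij_iff)
qed

lemma sum_permutes_conj_swap:
  "(\<Sum>\<pi> | \<pi> permutes B. \<phi> (\<pi> \<circ> swap i j)) = (\<Sum>\<pi> | \<pi> permutes swap i j ` B. \<phi> (swap i j \<circ> \<pi>))"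
proof -
  have invol: "swap i j ` swap i j ` B = B"
    by (simp add: image_comp)
  show ?thesis
    by (rule sum.reindex_bij_witness[where i = "\<lambda>\<pi>. swap i j \<circ> \<pi> \<circ> swap i j"
          and j = "\<lambda>\<pi>. swap i j \<circ> \<pi> \<circ> swap i j"])
      (use conj_swap_permutes[of _ B i j] conj_swap_permutes[of _ "swap i j ` B" i j] invol
        in \<open>auto simp: comp_assoc rewriteL_comp_comp[OF transpose_comp_involutory]\<close>)
qed

text \<open>The transpositions \<open>(j i)\<close> with \<open>i \<in> insert j B\<close> are representatives of the left as well as of the
  right cosets of \<open>Sym(B)\<close> in \<open>Sym(insert j B)\<close>; inversion exchanges the two decompositions.\<close>

lemma sum_permutes_insert_right:
  fixes \<phi> :: "(nat \<Rightarrow> nat) \<Rightarrow> real"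
  assumes "finite B" "j \<notin> B"
  shows "(\<Sum>\<pi> | \<pi> permutes insert j B. \<phi> \<pi>)
    = (\<Sum>i\<in>insert j B. \<Sum>\<pi> | \<pi> permutes B. \<phi> (\<pi> \<circ> swap j i))"
proof -
  have inv_bij: "(\<Sum>\<pi> | \<pi> permutes A. \<psi> (inv \<pi>)) = (\<Sum>\<pi> | \<pi> permutes A. \<psi> \<pi>)" for A and \<psi> :: "(nat \<Rightarrow> nat) \<Rightarrow> real"
    by (rule sum.reindex_bij_witness[where i = inv and j = inv])
      (auto simp: permutes_inv permutes_inv_inv)
  have "(\<Sum>\<pi> | \<pi> permutes insert j B. \<phi> \<pi>) = (\<Sum>\<pi> | \<pi> permutes insert j B. \<phi> (inv \<pi>))"
    by (rule inv_bij[symmetric])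
  also have "\<dots> = (\<Sum>i\<in>insert j B. \<Sum>\<pi> | \<pi> permutes B. \<phi> (inv (swap j i \<circ> \<pi>)))"
    by (rule sum_over_permutations_insert[OF assms])
  also have "\<dots> = (\<Sum>i\<in>insert j B. \<Sum>\<pi> | \<pi> permutes B. \<phi> (inv \<pi> \<circ> swap j i))"
    by (intro sum.cong refl) (simp add: o_inv_distrib permutes_bij)
  also have "\<dots> = (\<Sum>i\<in>insert j B. \<Sum>\<pi> | \<pi> permutes B. \<phi> (\<pi> \<circ> swap j i))"
    by (intro sum.cong refl inv_bij)
  finally show ?thesis .
qed

lemma sum_permutes_compose_left:
  assumes "\<rho> permutes B"
  shows "(\<Sum>\<pi> | \<pi> permutes B. \<phi> (\<rho> \<circ> \<pi>)) = (\<Sum>\<pi> | \<pi> permutes B. \<phi> \<pi>)"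
  by (rule setum_permutations_compose_left[OF assms, symmetric])


section \<open>The state space and its moves\<close>

locale hole_walk =
  fixes n f :: nat
  assumes n_ge_2: "2 \<le> n" and f_ge_1: "1 \<le> f" and f_le_n: "f \<le> n"
begin

definition matrix :: "nat \<Rightarrow> nat \<Rightarrow> nat" where
  "matrix = one_sided_matrix (\<lambda>i. if i \<le> f then 1 else 2)"

abbreviation S :: "(nat \<Rightarrow> nat) set" where
  "S \<equiv> restricted_perms n matrix"

text \<open>The pairs admissible at a permutation that has the value \<open>1\<close> at position \<open>p\<close>: the exchange
  carries \<open>1\<close> to position \<open>swap i j p\<close>.\<close>

definition moves :: "nat \<Rightarrow> (nat \<times> nat) set" where
  "moves p = {(i, j) \<in> {1..n} \<times> {1..n}. swap i j p \<le> f}"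

text \<open>The number of admissible pairs at every state (\<open>card_moves\<close>), and the quantity \<open>n + 2 \<Delta>\<close>
  (\<open>degree_eq_card_moves\<close>).\<close>

definition N :: real where
  "N = (real n)\<^sup>2 - 2 * real n + 2 * real f"

lemma N_ge: "2 * real f \<le> N" "real n \<le> 2 * N" "0 < N"
proof -
  have n2: "2 \<le> real n" "1 \<le> real f"
    using n_ge_2 f_ge_1 by auto
  have "0 \<le> real n * (real n - 2)"
    using n2 by (intro mult_nonneg_nonneg) auto
  then show 1: "2 * real f \<le> N"
    by (simp add: N_def power2_eq_square algebra_simps)
  then show "0 < N" using n2 by linarith
  have "0 \<le> (real n - 2) * (2 * real n - 1) + 2"
    using n2 by (intro add_nonneg_nonneg mult_nonneg_nonneg) auto
  then show "real n \<le> 2 * N"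
    using n2 by (simp add: N_def power2_eq_square algebra_simps)
qed

lemma in_S_iff:
  assumes "\<sigma> permutes {1..n}" "\<sigma> p = 1"
  shows "\<sigma> \<in> S \<longleftrightarrow> p \<le> f"
proof
  have p: "p \<in> {1..n}"
    using assms n_ge_2 permutes_in_image[OF assms(1), of p] by simp
  show "p \<le> f" if "\<sigma> \<in> S"
    using that p assms(2)
    by (auto simp: restricted_perms_def matrix_def one_sided_matrix_def split: if_splits)
  show "\<sigma> \<in> S" if "p \<le> f"
  proof -
    have "1 \<le> \<sigma> i" if "i \<in> {1..n}" for i
      using permutes_in_image[OF assms(1), of i] that by simp
    moreover have "\<sigma> i \<noteq> 1" if "\<not> i \<le> f" for i
      using that \<open>p \<le> f\<close> assms by (metis permutes_def)
    ultimately have "2 \<le> \<sigma> i" if "i \<in> {1..n}" "\<not> i \<le> f" for i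
      using that by (metis One_nat_def Suc_leI le_neq_implies_less numeral_2_eq_2)
    then show ?thesis
      using assms \<open>\<And>i. i \<in> {1..n} \<Longrightarrow> 1 \<le> \<sigma> i\<close>
      by (auto simp: restricted_perms_def matrix_def one_sided_matrix_def)
  qed
qed

lemma in_S_permutes: "\<sigma> \<in> S \<Longrightarrow> \<sigma> permutes {1..n}"
  by (simp add: restricted_perms_def)

lemma in_S_hole:
  assumes "\<sigma> \<in> S"
  obtains p where "p \<in> {1..f}" "\<sigma> p = 1"
proof -
  from in_S_permutes[OF assms] obtain p where p: "\<sigma> p = 1"
    by (metis permutes_def)
  have "p \<in> {1..n}"
    using p n_ge_2 permutes_in_image[OF in_S_permutes[OF assms], of p] by simp
  moreover have "p \<le> f"
    using in_S_iff[OF in_S_permutes[OF assms] p] assms by simp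
  ultimately show ?thesis
    using p by (intro that[of p]) simp_all
qed

lemma finite_S [simp]: "finite S"
  by (rule finite_subset[OF _ finite_permutations[of "{1..n}"]]) (auto dest: in_S_permutes)

lemma compose_in_S:
  assumes "\<sigma> \<in> S" "\<sigma> p = 1" "\<pi> permutes {1..n} - {p}"
  shows "\<sigma> \<circ> \<pi> \<in> S" "(\<sigma> \<circ> \<pi>) p = 1"
proof -
  show p: "(\<sigma> \<circ> \<pi>) p = 1"
    using assms by (simp add: permutes_not_in)
  have "p \<le> f"
    using assms in_S_iff in_S_permutes by blast
  then show "\<sigma> \<circ> \<pi> \<in> S"
    using in_S_iff[OF permutes_compose[OF permutes_subset[OF assms(3)] in_S_permutes[OF assms(1)]] p]
    by blast
qed

lemma swap_in_S:
  assumes "\<sigma> \<in> S" "\<sigma> p = 1" "(i, j) \<in> moves p"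
  shows "\<sigma> \<circ> swap i j \<in> S" "(\<sigma> \<circ> swap i j) (swap i j p) = 1" "swap i j p \<in> {1..f}"
proof -
  show p: "(\<sigma> \<circ> swap i j) (swap i j p) = 1"
    using assms by simp
  have perm: "\<sigma> \<circ> swap i j permutes {1..n}"
    using assms by (intro permutes_compose permutes_swap_id in_S_permutes) (auto simp: moves_def)
  then show "\<sigma> \<circ> swap i j \<in> S"
    using in_S_iff[OF perm p] assms(3) unfolding moves_def by blast
  show "swap i j p \<in> {1..f}"
    using p n_ge_2 permutes_in_image[OF perm, of "swap i j p"] assms(3) by (auto simp: moves_def)
qed

lemma admissible_pairs_eq_moves:
  assumes "\<sigma> \<in> S" "\<sigma> p = 1"
  shows "admissible_pairs n matrix \<sigma> = moves p"
proof -
  have "\<sigma> \<circ> swap i j \<in> S \<longleftrightarrow> swap i j p \<le> f" if "i \<in> {1..n}" "j \<in> {1..n}" for i j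
    using that assms by (intro in_S_iff permutes_compose permutes_swap_id in_S_permutes) auto
  then show ?thesis
    unfolding admissible_pairs_def moves_def by blast
qed

lemma finite_moves [simp]: "finite (moves p)"
  by (rule finite_subset[of _ "{1..n} \<times> {1..n}"]) (auto simp: moves_def)

text \<open>The transition rule of the hole, multiplied by \<open>N\<close>. There are two pairs for each position
  \<open>q \<le> f\<close> other than \<open>p\<close>, and \<open>(n - 1)\<^sup>2 + 1\<close> pairs that fix \<open>p\<close>; moving two of the latter into the
  sum over \<open>q\<close> leaves \<open>(n - 1)\<^sup>2 - 1 = N - 2 f\<close>.\<close>

lemma sum_moves:
  fixes \<phi> :: "nat \<Rightarrow> real"
  assumes p: "p \<in> {1..f}"
  shows "(\<Sum>(i, j)\<in>moves p. \<phi> (swap i j p)) = (N - 2 * real f) * \<phi> p + 2 * (\<Sum>q=1..f. \<phi> q)"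
proof -
  let ?O = "{1..n} - {p}" and ?Q = "{1..f} - {p}"
  have pn: "p \<in> {1..n}" "?Q \<subseteq> ?O"
    using p f_le_n by auto
  have eq: "moves p = (?O \<times> ?O) \<union> ({p} \<times> {1..f} \<union> ?Q \<times> {p})"
    using p f_le_n by (auto simp: moves_def Transposition.transpose_def split: if_splits)
  have "(\<Sum>(i, j)\<in>moves p. \<phi> (swap i j p))
      = (\<Sum>(i, j)\<in>?O \<times> ?O. \<phi> (swap i j p))
        + ((\<Sum>(i, j)\<in>{p} \<times> {1..f}. \<phi> (swap i j p)) + (\<Sum>(i, j)\<in>?Q \<times> {p}. \<phi> (swap i j p)))"
    unfolding eq by (subst sum.union_disjoint, auto)+
  also have "(\<Sum>(i, j)\<in>?O \<times> ?O. \<phi> (swap i j p)) = (\<Sum>z\<in>?O \<times> ?O. \<phi> p)"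
  proof (rule sum.cong[OF refl])
    fix z assume z: "z \<in> ?O \<times> ?O"
    then have "p \<noteq> fst z" "p \<noteq> snd z"
      by auto
    then show "(case z of (i, j) \<Rightarrow> \<phi> (swap i j p)) = \<phi> p"
      by (simp add: case_prod_unfold)
  qed
  also have "\<dots> = (real n - 1)\<^sup>2 * \<phi> p"
    using pn n_ge_2 by (simp add: card_cartesian_product power2_eq_square)
  also have "(\<Sum>(i, j)\<in>{p} \<times> {1..f}. \<phi> (swap i j p)) = (\<Sum>q=1..f. \<phi> q)"
    by (simp add: sum.cartesian_product[symmetric])
  also have "(\<Sum>(i, j)\<in>?Q \<times> {p}. \<phi> (swap i j p)) = (\<Sum>q\<in>?Q. \<phi> q)"
    by (simp add: sum.cartesian_product[symmetric])
  also have "\<dots> = (\<Sum>q=1..f. \<phi> q) - \<phi> p"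
    using p by (simp add: sum_diff1)
  finally show ?thesis
    by (simp add: N_def power2_eq_square algebra_simps)
qed

lemma card_moves: "p \<in> {1..f} \<Longrightarrow> real (card (moves p)) = N"
  using sum_moves[of p "\<lambda>_. 1"] by (simp add: case_prod_unfold)

section \<open>Deviation from uniformity, averaged over cosets\<close>

definition dev :: "nat \<Rightarrow> (nat \<Rightarrow> nat) \<Rightarrow> (nat \<Rightarrow> nat) \<Rightarrow> real" where
  "dev t \<sigma> x = pmf (rt_walk n matrix t \<sigma>) x - 1 / real (card S)"

lemma dev_Suc:
  assumes "\<sigma> \<in> S" "p \<in> {1..f}" "\<sigma> p = 1"
  shows "N * dev (Suc t) \<sigma> x = (\<Sum>(i, j)\<in>moves p. dev t (\<sigma> \<circ> swap i j) x)"
proof -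
  have ne: "moves p \<noteq> {}"
    using card_moves[OF assms(2)] N_ge by auto
  have "N * pmf (rt_walk n matrix (Suc t) \<sigma>) x
      = (\<Sum>(i, j)\<in>moves p. pmf (rt_walk n matrix t (\<sigma> \<circ> swap i j)) x)"
    using pmf_rt_walk_Suc[of n matrix \<sigma> t x] ne N_ge(3)
    by (simp add: admissible_pairs_eq_moves[OF assms(1,3)] card_moves[OF assms(2)])
  then show ?thesis
    by (simp add: dev_def case_prod_unfold sum_subtractf card_moves[OF assms(2)] right_diff_distrib)
qed

lemma set_rt_walk: "\<sigma> \<in> S \<Longrightarrow> set_pmf (rt_walk n matrix t \<sigma>) \<subseteq> S"
proof (induction t arbitrary: \<sigma>)
  case 0
  then show ?case by (simp add: rt_walk_0)
next
  case (Suc t)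
  from in_S_hole[OF Suc.prems] obtain p where p: "p \<in> {1..f}" "\<sigma> p = 1" .
  have ne: "moves p \<noteq> {}"
    using card_moves[OF p(1)] N_ge by auto
  have "set_pmf (rt_walk n matrix (Suc t) \<sigma>)
      = (\<Union>(i, j)\<in>moves p. set_pmf (rt_walk n matrix t (\<sigma> \<circ> swap i j)))"
    using ne by (simp add: rt_walk_Suc rt_step_def admissible_pairs_eq_moves[OF Suc.prems p(2)]
        case_prod_unfold)
  then show ?case
    using Suc.IH swap_in_S(1)[OF Suc.prems p(2)] by auto
qed

lemma sum_pmf_rt_walk: "\<sigma> \<in> S \<Longrightarrow> (\<Sum>x\<in>S. pmf (rt_walk n matrix t \<sigma>) x) = 1"
  by (intro sum_pmf_eq_1 set_rt_walk) auto

text \<open>The deviation when the walk starts from the uniform law on the coset \<open>\<sigma> Sym(B)\<close>.\<close>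

definition coset_dev :: "nat \<Rightarrow> (nat \<Rightarrow> nat) \<Rightarrow> nat set \<Rightarrow> (nat \<Rightarrow> nat) \<Rightarrow> real" where
  "coset_dev t \<sigma> B x = (\<Sum>\<pi> | \<pi> permutes B. dev t (\<sigma> \<circ> \<pi>) x) / fact (card B)"

lemma coset_dev_empty: "coset_dev t \<sigma> {} x = dev t \<sigma> x"
  by (simp add: coset_dev_def)

lemma coset_dev_compose:
  assumes "\<rho> permutes B"
  shows "coset_dev t (\<sigma> \<circ> \<rho>) B x = coset_dev t \<sigma> B x"
  using sum_permutes_compose_left[OF assms, of "\<lambda>\<pi>. dev t (\<sigma> \<circ> \<pi>) x"]
  by (simp add: coset_dev_def comp_assoc)

text \<open>The pairs whose effects on \<open>\<sigma> Sym(B)\<close> combine to \<open>\<sigma> Sym(insert j B)\<close>. Only one of the two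
  ordered pairs for each transposition of \<open>j\<close> with an element of \<open>B\<close> is taken, because the identity,
  that is the pair \<open>(j, j)\<close>, occurs once and all coset representatives need equal weight.\<close>

definition merging_moves :: "nat \<Rightarrow> nat set \<Rightarrow> (nat \<times> nat) set" where
  "merging_moves p B = Sigma ({1..n} - {p} - B) (\<lambda>j. insert j B)"

lemma merging_moves_subset:
  "p \<in> {1..f} \<Longrightarrow> B \<subseteq> {1..n} - {p} \<Longrightarrow> merging_moves p B \<subseteq> moves p"
  by (auto simp: merging_moves_def moves_def Transposition.transpose_def)

text \<open>The deviation after the first step is an average over the admissible pairs. The pairs outside
  \<open>merging_moves\<close> conjugate \<open>Sym(B)\<close>; the others add \<open>j\<close> to \<open>B\<close>, by \<open>sum_permutes_insert_right\<close>.\<close>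

lemma coset_dev_Suc:
  assumes \<sigma>: "\<sigma> \<in> S" "p \<in> {1..f}" "\<sigma> p = 1" and B: "B \<subseteq> {1..n} - {p}"
  shows "N * coset_dev (Suc t) \<sigma> B x
    = (\<Sum>(j, i)\<in>merging_moves p B. coset_dev t \<sigma> (insert j B) x)
      + (\<Sum>(i, j)\<in>moves p - merging_moves p B. coset_dev t (\<sigma> \<circ> swap i j) (swap i j ` B) x)"
proof -
  have fin: "finite B"
    using B finite_subset by blast
  note sub = merging_moves_subset[OF \<sigma>(2) B]
  \<comment> \<open>the contribution of the exchange of positions \<open>i\<close> and \<open>j\<close>\<close>
  define \<Phi> where "\<Phi> i j = (\<Sum>\<pi> | \<pi> permutes B. dev t (\<sigma> \<circ> \<pi> \<circ> swap i j) x) / fact (card B)" for i j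
  have "N * coset_dev (Suc t) \<sigma> B x = (\<Sum>\<pi> | \<pi> permutes B. N * dev (Suc t) (\<sigma> \<circ> \<pi>) x) / fact (card B)"
    by (simp add: coset_dev_def sum_distrib_left)
  also have "\<dots> = (\<Sum>\<pi> | \<pi> permutes B. \<Sum>(i, j)\<in>moves p. dev t (\<sigma> \<circ> \<pi> \<circ> swap i j) x) / fact (card B)"
    using compose_in_S[OF \<sigma>(1,3) permutes_subset[OF _ B]] \<sigma>(2)
    by (intro arg_cong2[where f = "(/)"] sum.cong dev_Suc refl) auto
  also have "\<dots> = (\<Sum>(i, j)\<in>moves p. \<Phi> i j)"
    unfolding \<Phi>_def case_prod_unfold by (subst sum.swap) (simp add: sum_divide_distrib)
  also have "\<dots> = (\<Sum>(i, j)\<in>merging_moves p B. \<Phi> i j) + (\<Sum>(i, j)\<in>moves p - merging_moves p B. \<Phi> i j)"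
    by (simp add: sum.subset_diff[OF sub] add.commute)
  also have "(\<Sum>(i, j)\<in>merging_moves p B. \<Phi> i j) = (\<Sum>(j, i)\<in>merging_moves p B. coset_dev t \<sigma> (insert j B) x)"
  proof -
    have "(\<Sum>i\<in>insert j B. \<Phi> j i) = (\<Sum>i\<in>insert j B. coset_dev t \<sigma> (insert j B) x)"
      if "j \<in> {1..n} - {p} - B" for j
    proof -
      have "(\<Sum>i\<in>insert j B. \<Phi> j i)
          = (\<Sum>\<pi> | \<pi> permutes insert j B. dev t (\<sigma> \<circ> \<pi>) x) / fact (card B)"
        using that fin
        by (simp add: \<Phi>_def sum_permutes_insert_right sum_divide_distrib[symmetric] comp_assoc
            add_divide_distrib)
      also have "\<dots> = real (Suc (card B)) * coset_dev t \<sigma> (insert j B) x"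
        using that fin by (simp add: coset_dev_def)
      finally show ?thesis
        using that fin by simp
    qed
    then show ?thesis
      unfolding merging_moves_def using fin by (simp add: sum.Sigma[symmetric])
  qed
  also have "(\<Sum>(i, j)\<in>moves p - merging_moves p B. \<Phi> i j)
      = (\<Sum>(i, j)\<in>moves p - merging_moves p B. coset_dev t (\<sigma> \<circ> swap i j) (swap i j ` B) x)"
    using sum_permutes_conj_swap[where B = B and \<phi> = "\<lambda>\<pi>. dev t (\<sigma> \<circ> \<pi>) x"]
    by (intro sum.cong refl)
      (simp add: \<Phi>_def coset_dev_def comp_assoc card_image split: prod.splits)
  finally show ?thesis .
qed


section \<open>The chain of the hole\<close>

text \<open>When \<open>B\<close> consists of all positions but the hole \<open>p\<close>, the coset is the set of all permutations
  with hole \<open>p\<close>.\<close>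

lemma coset_dev_full_cong:
  assumes "\<sigma> permutes {1..n}" "\<tau> permutes {1..n}" "\<sigma> p = 1" "\<tau> p = 1"
  shows "coset_dev t \<sigma> ({1..n} - {p}) x = coset_dev t \<tau> ({1..n} - {p}) x"
proof -
  have "inv \<tau> \<circ> \<sigma> permutes {1..n} - {p}"
  proof (rule permutes_superset)
    show "inv \<tau> \<circ> \<sigma> permutes {1..n}"
      using assms by (intro permutes_compose permutes_inv)
    show "(inv \<tau> \<circ> \<sigma>) y = y" if "y \<in> {1..n} - ({1..n} - {p})" for y
      using that assms by (auto simp: permutes_inv_eq)
  qed
  moreover have "\<tau> \<circ> (inv \<tau> \<circ> \<sigma>) = \<sigma>"
    using assms by (simp add: comp_assoc[symmetric] permutes_inv_o)
  ultimately show ?thesis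
    by (metis coset_dev_compose)
qed

text \<open>The deviation when only the hole is known; \<open>swap 1 p\<close> is a representative with hole \<open>p\<close>.\<close>

definition hole_dev :: "nat \<Rightarrow> nat \<Rightarrow> (nat \<Rightarrow> nat) \<Rightarrow> real" where
  "hole_dev t p x = coset_dev t (swap 1 p) ({1..n} - {p}) x"

lemma swap_1_in_S:
  assumes "p \<in> {1..f}"
  shows "swap 1 p \<in> S" "swap 1 p p = 1"
  using assms f_le_n n_ge_2 in_S_iff[OF permutes_swap_id, of 1 p p] by auto

lemma coset_dev_full:
  assumes "\<sigma> \<in> S" "p \<in> {1..f}" "\<sigma> p = 1"
  shows "coset_dev t \<sigma> ({1..n} - {p}) x = hole_dev t p x"
  unfolding hole_dev_def using assms swap_1_in_S[OF assms(2)] by (intro coset_dev_full_cong in_S_permutes) auto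

text \<open>No admissible pair is merging here, so the hole evolves autonomously.\<close>

lemma hole_dev_Suc:
  assumes p: "p \<in> {1..f}"
  shows "N * hole_dev (Suc t) p x = (N - 2 * real f) * hole_dev t p x + 2 * (\<Sum>q=1..f. hole_dev t q x)"
proof -
  note \<sigma> = swap_1_in_S[OF p]
  have "merging_moves p ({1..n} - {p}) = {}"
    by (auto simp: merging_moves_def)
  then have "N * hole_dev (Suc t) p x
      = (\<Sum>(i, j)\<in>moves p. coset_dev t (swap 1 p \<circ> swap i j) (swap i j ` ({1..n} - {p})) x)"
    using coset_dev_Suc[OF \<sigma>(1) p \<sigma>(2) subset_refl, of t x] by (simp add: hole_dev_def)
  also have "\<dots> = (\<Sum>(i, j)\<in>moves p. hole_dev t (swap i j p) x)"
  proof (intro sum.cong refl, clarify)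
    fix i j assume ij: "(i, j) \<in> moves p"
    have "swap i j ` {1..n} = {1..n}"
      using ij by (intro permutes_image permutes_swap_id) (auto simp: moves_def)
    then have "swap i j ` ({1..n} - {p}) = {1..n} - {swap i j p}"
      by (simp add: image_set_diff)
    then show "coset_dev t (swap 1 p \<circ> swap i j) (swap i j ` ({1..n} - {p})) x = hole_dev t (swap i j p) x"
      by (simp only: coset_dev_full[OF swap_in_S(1,3,2)[OF \<sigma> ij]])
  qed
  finally show ?thesis
    using sum_moves[OF p] by simp
qed

lemma hole_dev_0:
  assumes p: "p \<in> {1..f}" and x: "x \<in> S"
  shows "hole_dev 0 p x = of_bool (x p = 1) / fact (n - 1) - 1 / real (card S)"
proof -
  let ?B = "{1..n} - {p}"
  note \<sigma> = swap_1_in_S[OF p]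
  have card: "card ?B = n - 1"
    using p f_le_n by simp
  have unique: "swap 1 p \<circ> \<pi> = x \<longleftrightarrow> \<pi> = swap 1 p \<circ> x" for \<pi>
    by (metis comp_assoc id_comp transpose_comp_involutory)
  have perm: "swap 1 p \<circ> x permutes ?B \<longleftrightarrow> x p = 1"
  proof
    assume "swap 1 p \<circ> x permutes ?B"
    then have "swap 1 p (x p) = p"
      by (metis DiffD2 comp_apply permutes_not_in singletonI)
    then show "x p = 1"
      by (metis transpose_apply_second transpose_involutory)
  next
    assume xp: "x p = 1"
    show "swap 1 p \<circ> x permutes ?B"
    proof (rule permutes_superset)
      show "swap 1 p \<circ> x permutes {1..n}"
        using x \<sigma> by (intro permutes_compose in_S_permutes)
    qed (use xp in auto)
  qed
  have "(\<Sum>\<pi> | \<pi> permutes ?B. pmf (return_pmf (swap 1 p \<circ> \<pi>)) x)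
      = (\<Sum>\<pi> | \<pi> permutes ?B. if \<pi> = swap 1 p \<circ> x then 1 else 0)"
    using unique by (intro sum.cong refl) (auto simp: indicator_def)
  also have "\<dots> = of_bool (x p = 1)"
    using perm by (subst sum.delta) (auto simp: finite_permutations)
  finally show ?thesis
    using card_permutations[OF card]
    unfolding hole_dev_def coset_dev_def dev_def rt_walk_0 card sum_subtractf
    by (simp add: diff_divide_distrib del: pmf_return)
qed

lemma sum_hole: "x \<in> S \<Longrightarrow> (\<Sum>p=1..f. of_bool (x p = 1)) = (1 :: real)"
proof -
  assume x: "x \<in> S"
  from in_S_hole[OF x] obtain q where q: "q \<in> {1..f}" "x q = 1" .
  have "x p = 1 \<longleftrightarrow> p = q" for p
    using q permutes_inj[OF in_S_permutes[OF x]] by (metis injD)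
  then show ?thesis
    using q(1) by (simp add: of_bool_def)
qed

lemma S_nonempty: "S \<noteq> {}"
  using swap_1_in_S[of 1] f_ge_1 by auto

text \<open>The deviation sums to zero over the state space; for time \<open>0\<close> this counts the permutations with
  hole \<open>p\<close>.\<close>

lemma card_hole:
  assumes p: "p \<in> {1..f}"
  shows "(\<Sum>x\<in>S. of_bool (x p = 1)) = (fact (n - 1) :: real)"
proof -
  note \<sigma> = swap_1_in_S[OF p]
  have "(\<Sum>x\<in>S. hole_dev 0 p x) = 0"
  proof -
    have "(\<Sum>x\<in>S. dev 0 (swap 1 p \<circ> \<pi>) x) = 0" if "\<pi> permutes {1..n} - {p}" for \<pi>
      using sum_pmf_rt_walk[OF compose_in_S(1)[OF \<sigma> that], of 0] S_nonempty
      by (simp add: dev_def sum_subtractf)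
    then show ?thesis
      unfolding hole_dev_def coset_dev_def sum_divide_distrib[symmetric] by (subst sum.swap) simp
  qed
  then show ?thesis
    using S_nonempty
    by (simp add: hole_dev_0[OF p] sum_subtractf sum_divide_distrib[symmetric] del: sum_of_bool_eq)
qed

lemma card_S: "real (card S) = real f * fact (n - 1)"
proof -
  have "real (card S) = (\<Sum>x\<in>S. \<Sum>p=1..f. of_bool (x p = 1))"
    by (simp only: sum_hole cong: sum.cong) simp
  also have "\<dots> = (\<Sum>p=1..f. \<Sum>x\<in>S. of_bool (x p = 1))"
    by (rule sum.swap)
  also have "\<dots> = real f * fact (n - 1)"
    by (simp only: card_hole cong: sum.cong) simp
  finally show ?thesis .
qed

text \<open>Stationarity of the uniform law, seen by the hole: the sum vanishes at time \<open>0\<close>, and once it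
  vanishes the recursion multiplies every term by the same factor.\<close>

lemma sum_hole_dev:
  assumes "x \<in> S"
  shows "(\<Sum>p=1..f. hole_dev t p x) = 0"
proof (induction t)
  case 0
  have "(\<Sum>p=1..f. hole_dev 0 p x) = (\<Sum>p=1..f. of_bool (x p = 1) / fact (n - 1) - 1 / real (card S))"
    using assms by (intro sum.cong refl hole_dev_0)
  also have "\<dots> = 1 / fact (n - 1) - real f / real (card S)"
    unfolding sum_subtractf sum_divide_distrib[symmetric] sum_hole[OF assms] by simp
  finally show ?case
    using f_ge_1 by (simp add: card_S)
next
  case (Suc t)
  have "N * (\<Sum>p=1..f. hole_dev (Suc t) p x) = (\<Sum>p=1..f. N * hole_dev (Suc t) p x)"
    by (simp add: sum_distrib_left)
  also have "\<dots> = (\<Sum>p=1..f. (N - 2 * real f) * hole_dev t p x)"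
    using hole_dev_Suc[of _ t x] Suc by (intro sum.cong refl) simp
  also have "\<dots> = 0"
    unfolding sum_distrib_left[symmetric] Suc by simp
  finally show ?case
    using N_ge by simp
qed

lemma hole_dev_geometric:
  assumes "p \<in> {1..f}" "x \<in> S"
  shows "hole_dev t p x = (1 - 2 * real f / N) ^ t * hole_dev 0 p x"
proof (induction t)
  case (Suc t)
  have "N * hole_dev (Suc t) p x = (N - 2 * real f) * hole_dev t p x"
    using hole_dev_Suc[OF assms(1), of t x] sum_hole_dev[OF assms(2), of t] by simp
  then have "hole_dev (Suc t) p x = (1 - 2 * real f / N) * hole_dev t p x"
    using N_ge by (simp add: field_simps)
  then show ?case
    by (simp add: Suc)
qed simp

section \<open>Bounds on the distance to uniformity\<close>

definition coset_dist :: "nat \<Rightarrow> (nat \<Rightarrow> nat) \<Rightarrow> nat set \<Rightarrow> real" where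
  "coset_dist t \<sigma> B = 1 / 2 * (\<Sum>x\<in>S. \<bar>coset_dev t \<sigma> B x\<bar>)"

lemma rt_dist_eq_Max: "rt_dist n matrix t = (MAX \<sigma>\<in>S. coset_dist t \<sigma> {})"
  unfolding rt_dist_def tv_dist_on_def coset_dist_def coset_dev_empty dev_def
  using S_nonempty by simp

text \<open>The deviation vector is multiplied by \<open>1 - 2 f / N\<close> in every step, and the uniform law on the
  permutations with hole \<open>p\<close>, a fraction \<open>1 / f\<close> of all states, is at distance \<open>1 - 1 / f\<close> from
  the uniform law on all states.\<close>

lemma coset_dist_full:
  assumes "\<sigma> \<in> S" "p \<in> {1..f}" "\<sigma> p = 1"
  shows "coset_dist t \<sigma> ({1..n} - {p}) = (1 - 2 * real f / N) ^ t * (1 - 1 / real f)"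
proof -
  let ?\<beta> = "1 - 2 * real f / N"
  have "0 \<le> ?\<beta>"
    using N_ge by (simp add: field_simps)
  then have "\<bar>coset_dev t \<sigma> ({1..n} - {p}) x\<bar> = ?\<beta> ^ t * \<bar>hole_dev 0 p x\<bar>" if "x \<in> S" for x
    unfolding coset_dev_full[OF assms] hole_dev_geometric[OF assms(2) that, of t] abs_mult by simp
  then have "(\<Sum>x\<in>S. \<bar>coset_dev t \<sigma> ({1..n} - {p}) x\<bar>) = (\<Sum>x\<in>S. ?\<beta> ^ t * \<bar>hole_dev 0 p x\<bar>)"
    by (rule sum.cong[OF refl])
  then have "coset_dist t \<sigma> ({1..n} - {p}) = ?\<beta> ^ t * (1 / 2 * (\<Sum>x\<in>S. \<bar>hole_dev 0 p x\<bar>))"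
    unfolding coset_dist_def sum_distrib_left[symmetric] by simp
  \<comment> \<open>the absolute value is written as an affine function of the indicator \<open>of_bool (x p = 1)\<close>\<close>
  also have "(\<Sum>x\<in>S. \<bar>hole_dev 0 p x\<bar>)
      = (\<Sum>x\<in>S. of_bool (x p = 1) * (1 - 2 / real f) / fact (n - 1) + 1 / real (card S))"
    using f_ge_1 by (intro sum.cong refl) (auto simp: hole_dev_0[OF assms(2)] card_S field_simps)
  also have "\<dots> = 2 * (1 - 1 / real f)"
    unfolding sum.distrib sum_divide_distrib[symmetric] sum_distrib_right[symmetric]
      card_hole[OF assms(2)]
    using S_nonempty by simp
  also have "?\<beta> ^ t * (1 / 2 * (2 * (1 - 1 / real f))) = ?\<beta> ^ t * (1 - 1 / real f)"
    by simp
  finally show ?thesis .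
qed

text \<open>The total variation distance is convex, and a coset law is an average of point masses.\<close>

lemma coset_dist_le_of_points:
  assumes "finite B" "\<And>\<pi>. \<pi> permutes B \<Longrightarrow> coset_dist t (\<sigma> \<circ> \<pi>) {} \<le> c"
  shows "coset_dist t \<sigma> B \<le> c"
proof -
  have "coset_dist t \<sigma> B \<le> 1 / 2 * (\<Sum>x\<in>S. (\<Sum>\<pi> | \<pi> permutes B. \<bar>dev t (\<sigma> \<circ> \<pi>) x\<bar>) / fact (card B))"
    unfolding coset_dist_def coset_dev_def by (intro mult_left_mono sum_mono) (auto intro: divide_right_mono)
  also have "\<dots> = (\<Sum>\<pi> | \<pi> permutes B. coset_dist t (\<sigma> \<circ> \<pi>) {}) / fact (card B)"
    unfolding coset_dist_def coset_dev_empty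
    by (simp add: sum_divide_distrib[symmetric] sum_distrib_left[symmetric]) (subst sum.swap, simp)
  also have "\<dots> \<le> (\<Sum>\<pi> | \<pi> permutes B. c) / fact (card B)"
    using assms by (intro divide_right_mono sum_mono) auto
  also have "\<dots> = c"
    using assms(1) by (simp add: card_permutations[OF refl])
  finally show ?thesis .
qed

lemma point_dist_le_1: "\<sigma> \<in> S \<Longrightarrow> coset_dist t \<sigma> {} \<le> 1"
proof -
  assume \<sigma>: "\<sigma> \<in> S"
  have "coset_dist t \<sigma> {} \<le> 1 / 2 * (\<Sum>x\<in>S. pmf (rt_walk n matrix t \<sigma>) x + 1 / real (card S))"
    unfolding coset_dist_def coset_dev_empty dev_def
    by (intro mult_left_mono sum_mono order.trans[OF abs_triangle_ineq4]) auto
  also have "\<dots> = 1"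
    using S_nonempty by (simp add: sum.distrib sum_pmf_rt_walk[OF \<sigma>])
  finally show ?thesis .
qed

text \<open>The worst point start is at least as bad as the average over all starts with a given hole.\<close>

lemma rt_dist_ge: "(1 - 2 * real f / N) ^ t * (1 - 1 / real f) \<le> rt_dist n matrix t"
proof -
  have p: "(1::nat) \<in> {1..f}"
    using f_ge_1 by simp
  note \<sigma> = swap_1_in_S[OF p]
  have "coset_dist t (swap 1 1) ({1..n} - {1}) \<le> rt_dist n matrix t"
  proof (rule coset_dist_le_of_points)
    fix \<pi> assume "\<pi> permutes {1..n} - {1}"
    then have "swap 1 1 \<circ> \<pi> \<in> S"
      by (rule compose_in_S(1)[OF \<sigma>])
    then show "coset_dist t (swap 1 1 \<circ> \<pi>) {} \<le> rt_dist n matrix t"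
      unfolding rt_dist_eq_Max by (intro Max_ge finite_imageI finite_S imageI)
  qed simp
  then show ?thesis
    unfolding coset_dist_full[OF \<sigma>(1) p \<sigma>(2)] .
qed

lemma coset_dist_Suc_le:
  assumes \<sigma>: "\<sigma> \<in> S" "p \<in> {1..f}" "\<sigma> p = 1" and B: "B \<subseteq> {1..n} - {p}"
  shows "N * coset_dist (Suc t) \<sigma> B
    \<le> (\<Sum>(j, i)\<in>merging_moves p B. coset_dist t \<sigma> (insert j B))
      + (\<Sum>(i, j)\<in>moves p - merging_moves p B. coset_dist t (\<sigma> \<circ> swap i j) (swap i j ` B))"
proof -
  have "N * coset_dist (Suc t) \<sigma> B = 1 / 2 * (\<Sum>x\<in>S. \<bar>N * coset_dev (Suc t) \<sigma> B x\<bar>)"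
    using N_ge by (simp add: coset_dist_def abs_mult sum_distrib_left mult.left_commute)
  also have "\<dots> \<le> 1 / 2 * (\<Sum>x\<in>S. (\<Sum>(j, i)\<in>merging_moves p B. \<bar>coset_dev t \<sigma> (insert j B) x\<bar>)
      + (\<Sum>(i, j)\<in>moves p - merging_moves p B. \<bar>coset_dev t (\<sigma> \<circ> swap i j) (swap i j ` B) x\<bar>))"
    unfolding coset_dev_Suc[OF assms] case_prod_unfold
    by (intro mult_left_mono sum_mono order.trans[OF abs_triangle_ineq] add_mono sum_abs) auto
  also have "\<dots> = (\<Sum>(j, i)\<in>merging_moves p B. coset_dist t \<sigma> (insert j B))
      + (\<Sum>(i, j)\<in>moves p - merging_moves p B. coset_dist t (\<sigma> \<circ> swap i j) (swap i j ` B))"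
    unfolding coset_dist_def case_prod_unfold sum.distrib distrib_left sum_distrib_left
    by (intro arg_cong2[where f = "(+)"] sum.swap)
  finally show ?thesis .
qed

text \<open>A set \<open>B\<close> of size \<open>k\<close> grows with probability \<open>(k + 1) (n - 1 - k) / N\<close>. The potential \<open>pot k\<close> is
  chosen to contract at least by the factor \<open>1 - n / (2 N)\<close> on average in each step,
  uniformly in \<open>k\<close> (\<open>pot_step\<close>): growth is slowest for small \<open>k\<close> and for \<open>k\<close> near \<open>n - 1\<close>, and there the quotient \<open>(n - 1 - k) / (k + 1)\<close>
  drops by the largest factor. It is normalised to be at least \<open>1\<close> for \<open>k < n - 1\<close> and vanishes at
  \<open>k = n - 1\<close>, so that it bounds the probability that \<open>B\<close> is not yet full.\<close>

definition pot :: "nat \<Rightarrow> real" where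
  "pot k = (real n - 1) * (real n - 1 - real k) / (real k + 1)"

lemma pot_step:
  assumes "real k \<le> real n - 1"
  shows "(real k + 1) * (real n - 1 - real k) * pot (Suc k)
    + (N - (real k + 1) * (real n - 1 - real k)) * pot k \<le> (N - real n / 2) * pot k"
proof -
  define w where "w = (real n - 1) * (real n - 1 - real k) * real n"
  have w: "0 \<le> w"
    using assms n_ge_2 by (simp add: w_def)
  have "pot k - pot (Suc k) = (real n - 1) * real n / ((real k + 1) * (real k + 2))"
  proof -
    have pot_alt: "pot j = (real n - 1) * (real n * (1 / (real j + 1)) - 1)" for j
      by (simp add: pot_def field_simps)
    have "M * (c * u - 1) - M * (c * v - 1) = M * c * (u - v)" for M c u v :: real
      by (simp add: algebra_simps)
    from this[of "real n - 1" "real n"] have "pot k - pot (Suc k)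
        = (real n - 1) * real n * (1 / (real k + 1) - 1 / (real (Suc k) + 1))"
      unfolding pot_alt .
    also have "real (Suc k) + 1 = real k + 2"
      by simp
    also have "1 / (real k + 1) - 1 / (real k + 2) = 1 / ((real k + 1) * (real k + 2))"
      by (simp add: field_simps)
    finally show ?thesis by simp
  qed
  then have "(real k + 1) * (real n - 1 - real k) * (pot k - pot (Suc k)) = w / (real k + 2)"
    by (simp add: w_def)
  moreover have "real n / 2 * pot k = w / (2 * (real k + 1))"
    by (simp add: pot_def w_def divide_simps)
  moreover have "w / (2 * (real k + 1)) \<le> w / (real k + 2)"
    using w by (intro divide_left_mono) auto
  ultimately have "real n / 2 * pot k \<le> (real k + 1) * (real n - 1 - real k) * (pot k - pot (Suc k))"
    by linarith
  then show ?thesis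
    by (simp add: algebra_simps)
qed

text \<open>In \<open>s\<close> steps \<open>B\<close> fails to fill up with probability at most \<open>pot (card B) (1 - n / (2 N)) ^ s\<close>; in the
  other \<open>t\<close> steps a full \<open>B\<close> contributes \<open>(1 - 2 f / N) ^ t\<close>. The induction on \<open>s\<close> keeps \<open>t\<close> fixed,
  since the second term need not decrease along the way.\<close>

lemma coset_dist_le:
  assumes "\<sigma> \<in> S" "p \<in> {1..f}" "\<sigma> p = 1" and "B \<subseteq> {1..n} - {p}"
  shows "coset_dist (s + t) \<sigma> B \<le> pot (card B) * (1 - real n / (2 * N)) ^ s + (1 - 2 * real f / N) ^ t"
  using assms
proof (induction s arbitrary: \<sigma> p B)
  case 0
  let ?\<beta> = "1 - 2 * real f / N"
  have \<beta>: "0 \<le> ?\<beta>" "1 - 1 / real f \<le> 1"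
    using N_ge by (auto simp: field_simps)
  have card: "card ({1..n} - {p}) = n - 1"
    using 0 f_le_n by simp
  show ?case
  proof (cases "B = {1..n} - {p}")
    case True
    have "coset_dist t \<sigma> B \<le> ?\<beta> ^ t * 1"
      unfolding True coset_dist_full[OF 0(1-3)] using \<beta> by (intro mult_left_mono) auto
    moreover have "0 \<le> pot (card B)"
      using n_ge_2 card True by (simp add: pot_def)
    ultimately show ?thesis by simp
  next
    case False
    then have "card B < n - 1"
      using 0(4) card by (metis finite_Diff finite_atLeastAtMost psubsetI psubset_card_mono)
    then have "real (card B) + 1 \<le> real n - 1" "1 \<le> real n - 1 - real (card B)"
      by linarith+
    then have "(real (card B) + 1) * 1 \<le> (real n - 1) * (real n - 1 - real (card B))"
      by (intro mult_mono) auto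
    then have "1 \<le> pot (card B)"
      by (simp add: pot_def field_simps)
    moreover have "coset_dist t \<sigma> B \<le> 1"
    proof (rule coset_dist_le_of_points)
      show "finite B"
        using 0(4) finite_subset by blast
    qed (intro point_dist_le_1 compose_in_S(1)[OF 0(1,3)] permutes_subset[OF _ 0(4)])
    ultimately show ?thesis
      using \<beta> by (simp add: add_increasing2)
  qed
next
  case (Suc s)
  let ?\<alpha> = "1 - real n / (2 * N)" and ?b = "(1 - 2 * real f / N) ^ t"
  define k where "k = card B"
  \<comment> \<open>the number of merging moves\<close>
  define m where "m = (real k + 1) * (real n - 1 - real k)"
  have fin: "finite B"
    using Suc.prems(4) finite_subset by blast
  have "card ({1..n} - {p}) = n - 1"
    using Suc.prems f_le_n by simp
  then have k: "real k \<le> real n - 1"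
    using card_mono[OF _ Suc.prems(4)] n_ge_2 by (simp add: k_def)
  note sub = merging_moves_subset[OF Suc.prems(2,4)]
  have fin_merging: "finite (merging_moves p B)"
    using fin by (simp add: merging_moves_def)
  have "card (merging_moves p B) = (\<Sum>j\<in>{1..n} - {p} - B. card (insert j B))"
    unfolding merging_moves_def using fin by (subst card_SigmaI) auto
  also have "\<dots> = (n - 1 - k) * Suc k"
    using fin Suc.prems(2,4) f_le_n by (simp add: k_def card_Diff_subset)
  finally have "real (card (merging_moves p B)) = real (n - 1 - k) * real (Suc k)"
    by (simp only: of_nat_mult)
  moreover have "real (n - 1 - k) = real n - 1 - real k"
    using k n_ge_2 by linarith
  ultimately have card_merging: "real (card (merging_moves p B)) = m"
    by (simp add: m_def algebra_simps)
  have card_rest: "real (card (moves p - merging_moves p B)) = N - m"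
    using card_moves[OF Suc.prems(2)] card_merging sub card_mono[OF finite_moves sub]
    by (simp add: card_Diff_subset[OF fin_merging sub])
  have merged: "coset_dist (s + t) \<sigma> (insert j B) \<le> pot (Suc k) * ?\<alpha> ^ s + ?b"
    if "(j, i) \<in> merging_moves p B" for i j
    using Suc.IH[OF Suc.prems(1-3), of "insert j B"] that Suc.prems(4) fin
    by (simp add: merging_moves_def k_def)
  have kept: "coset_dist (s + t) (\<sigma> \<circ> swap i j) (swap i j ` B) \<le> pot k * ?\<alpha> ^ s + ?b"
    if ij: "(i, j) \<in> moves p" for i j
  proof -
    have "swap i j ` B \<subseteq> swap i j ` ({1..n} - {p})"
      using Suc.prems(4) by blast
    also have "\<dots> = {1..n} - {swap i j p}"
      using ij permutes_image[OF permutes_swap_id[of i "{1..n}" j]]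
      by (simp add: image_set_diff moves_def)
    finally have "swap i j ` B \<subseteq> {1..n} - {swap i j p}" .
    moreover have "card (swap i j ` B) = k"
      by (simp add: k_def card_image)
    ultimately show ?thesis
      using Suc.IH[OF swap_in_S(1,3,2)[OF Suc.prems(1,3) ij], of "swap i j ` B"] by (simp only:)
  qed
  have "N * coset_dist (Suc s + t) \<sigma> B
      \<le> (\<Sum>z\<in>merging_moves p B. pot (Suc k) * ?\<alpha> ^ s + ?b)
        + (\<Sum>z\<in>moves p - merging_moves p B. pot k * ?\<alpha> ^ s + ?b)"
  proof -
    have "N * coset_dist (Suc s + t) \<sigma> B
        \<le> (\<Sum>(j, i)\<in>merging_moves p B. coset_dist (s + t) \<sigma> (insert j B))
        + (\<Sum>(i, j)\<in>moves p - merging_moves p B. coset_dist (s + t) (\<sigma> \<circ> swap i j) (swap i j ` B))"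
      using coset_dist_Suc_le[OF Suc.prems, of "s + t"] by (simp only: add_Suc)
    also have "\<dots> \<le> (\<Sum>z\<in>merging_moves p B. pot (Suc k) * ?\<alpha> ^ s + ?b)
        + (\<Sum>z\<in>moves p - merging_moves p B. pot k * ?\<alpha> ^ s + ?b)"
      by (intro add_mono sum_mono; clarify) (blast intro: merged kept)+
    finally show ?thesis .
  qed
  also have "\<dots> = (m * pot (Suc k) + (N - m) * pot k) * ?\<alpha> ^ s + N * ?b"
    by (simp add: card_merging card_rest algebra_simps)
  also have "\<dots> \<le> ((N - real n / 2) * pot k) * ?\<alpha> ^ s + N * ?b"
    using pot_step[OF k] N_ge
    by (intro add_right_mono mult_right_mono) (auto simp: m_def field_simps)
  also have "\<dots> = N * (pot k * ?\<alpha> ^ Suc s + ?b)"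
    using N_ge by (simp add: field_simps)
  finally show ?case
    using N_ge by (simp add: k_def)
qed

lemma rt_dist_le:
  "rt_dist n matrix (s + t)
    \<le> (real n)\<^sup>2 * (1 - real n / (2 * N)) ^ s + (1 - 2 * real f / N) ^ t"
proof -
  have "coset_dist (s + t) \<sigma> {} \<le> (real n)\<^sup>2 * (1 - real n / (2 * N)) ^ s + (1 - 2 * real f / N) ^ t"
    if \<sigma>: "\<sigma> \<in> S" for \<sigma>
  proof -
    from in_S_hole[OF \<sigma>] obtain p where "p \<in> {1..f}" "\<sigma> p = 1" .
    then have "coset_dist (s + t) \<sigma> {} \<le> pot 0 * (1 - real n / (2 * N)) ^ s + (1 - 2 * real f / N) ^ t"
      using coset_dist_le[OF \<sigma>, of p "{}"] by simp
    moreover have "pot 0 \<le> (real n)\<^sup>2"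
      using n_ge_2 by (auto simp: pot_def power2_eq_square intro!: mult_mono)
    moreover have "0 \<le> 1 - real n / (2 * N)"
      using N_ge by (simp add: field_simps)
    ultimately show ?thesis
      by (meson add_right_mono mult_right_mono order.trans zero_le_power)
  qed
  then show ?thesis
    unfolding rt_dist_eq_Max using S_nonempty by simp
qed

section \<open>Mixing times\<close>

text \<open>This ensures that the minimum defining the mixing time is attained, for every positive level.\<close>

lemma rt_dist_vanishes:
  assumes "0 < \<epsilon>"
  shows "\<exists>t. rt_dist n matrix t \<le> \<epsilon>"
proof -
  let ?\<alpha> = "1 - real n / (2 * N)" and ?\<beta> = "1 - 2 * real f / N"
  have "0 \<le> ?\<alpha>" "?\<alpha> < 1" "0 \<le> ?\<beta>" "?\<beta> < 1"
    using N_ge n_ge_2 f_ge_1 by (auto simp: field_simps)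
  then have "(\<lambda>t. (real n)\<^sup>2 * ?\<alpha> ^ t + ?\<beta> ^ t) \<longlonglongrightarrow> (real n)\<^sup>2 * 0 + 0"
    by (intro tendsto_intros LIMSEQ_realpow_zero)
  then have "\<forall>\<^sub>F t in sequentially. (real n)\<^sup>2 * ?\<alpha> ^ t + ?\<beta> ^ t < \<epsilon>"
    using assms by (intro order_tendstoD(2)) auto
  then obtain t where "(real n)\<^sup>2 * ?\<alpha> ^ t + ?\<beta> ^ t < \<epsilon>"
    by (auto simp: eventually_sequentially)
  then show ?thesis
    using rt_dist_le[of t t] by (intro exI[of _ "t + t"]) linarith
qed

text \<open>With \<open>x = 2 f / N \<le> 1 / 2\<close> one has \<open>1 - x \<ge> exp (- 2 x)\<close>, and \<open>1 - 1 / f \<ge> 1 / 2\<close>; so the lower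
  bound on the distance gives \<open>exp (- 4 f t / N) \<le> 2 \<epsilon>\<close> at the mixing time \<open>t\<close>.\<close>

lemma mixing_time_ge:
  assumes "2 \<le> f" "4 * real f \<le> N" "0 < \<epsilon>"
  shows "ln (1 / (2 * \<epsilon>)) / 4 * (N / real f) \<le> real (rt_mixing_time n matrix \<epsilon>)"
proof -
  define \<tau> where "\<tau> = rt_mixing_time n matrix \<epsilon>"
  define x where "x = 2 * real f / N"
  have x: "0 < x" "x \<le> 1 / 2"
    using assms N_ge f_ge_1 by (auto simp: x_def field_simps)
  have "(1 - x) ^ \<tau> * (1 / 2) \<le> (1 - x) ^ \<tau> * (1 - 1 / real f)"
    using assms(1) x by (intro mult_left_mono) (auto simp: field_simps)
  also have "\<dots> \<le> rt_dist n matrix \<tau>"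
    unfolding x_def by (rule rt_dist_ge)
  also have "\<dots> \<le> \<epsilon>"
    unfolding \<tau>_def rt_mixing_time_def using rt_dist_vanishes[OF assms(3)] by (rule LeastI_ex)
  finally have "(1 - x) ^ \<tau> \<le> 2 * \<epsilon>"
    by simp
  moreover have "0 < (1 - x) ^ \<tau>"
    using x by simp
  ultimately have "ln ((1 - x) ^ \<tau>) \<le> ln (2 * \<epsilon>)"
    using assms(3) by (subst ln_le_cancel_iff) auto
  then have "real \<tau> * ln (1 - x) \<le> ln (2 * \<epsilon>)"
    using x by (simp add: ln_realpow)
  moreover have "- 2 * x \<le> ln (1 - x)"
  proof -
    have "x\<^sup>2 \<le> x * (1 / 2)"
      unfolding power2_eq_square using x by (intro mult_left_mono) auto
    then show ?thesis
      using ln_one_minus_pos_lower_bound[of x] x by linarith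
  qed
  then have "real \<tau> * (- 2 * x) \<le> real \<tau> * ln (1 - x)"
    by (intro mult_left_mono) auto
  ultimately have "ln (1 / (2 * \<epsilon>)) \<le> real \<tau> * (2 * x)"
    using assms(3) by (simp add: ln_div)
  then show ?thesis
    using N_ge f_ge_1 by (simp add: x_def \<tau>_def field_simps)
qed

text \<open>Take \<open>s = t = \<lceil>2 N / f\<rceil>\<close> in \<open>rt_dist_le\<close>. The first term is then at most
  \<open>n\<^sup>2 exp (- n / f) \<le> n\<^sup>2 exp (- 5 ln n) = 1 / n ^ 3\<close>; this is where the bound on \<open>f\<close> enters. The second
  term is at most \<open>exp (- 4)\<close>.\<close>

lemma mixing_time_le:
  assumes "real f \<le> real n / (5 * ln (real n))" "1 / 4 \<le> \<epsilon>"
  shows "real (rt_mixing_time n matrix \<epsilon>) \<le> 6 * (N / real f)"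
proof -
  define s where "s = nat \<lceil>2 * N / real f\<rceil>"
  have s: "2 * N / real f \<le> real s"
    unfolding s_def by (rule real_nat_ceiling_ge)
  have ln_n: "0 < ln (real n)"
    using n_ge_2 by simp
  have pow_le: "(1 - y) ^ s \<le> exp (- (y * (2 * N / real f)))" if "0 \<le> y" "y \<le> 1" for y
  proof -
    have "(1 - y) ^ s \<le> exp (- y) ^ s"
      using that exp_ge_add_one_self[of "- y"] by (intro power_mono) auto
    also have "\<dots> = exp (- (y * real s))"
      by (simp add: exp_of_nat_mult[symmetric] mult.commute)
    also have "\<dots> \<le> exp (- (y * (2 * N / real f)))"
      unfolding exp_le_cancel_iff neg_le_iff_le using s that(1) by (rule mult_left_mono)
    finally show ?thesis .
  qed
  have "(1 - real n / (2 * N)) ^ s \<le> exp (- (real n / (2 * N) * (2 * N / real f)))"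
    using N_ge by (intro pow_le) (auto simp: field_simps)
  also have "\<dots> \<le> exp (- (real 5 * ln (real n)))"
    using assms(1) N_ge f_ge_1 ln_n by (simp add: field_simps)
  also have "\<dots> = 1 / real n ^ 5"
    unfolding exp_minus exp_of_nat_mult using n_ge_2 by (simp add: divide_inverse)
  finally have "(real n)\<^sup>2 * (1 - real n / (2 * N)) ^ s \<le> (real n)\<^sup>2 * (1 / real n ^ 5)"
    by (intro mult_left_mono) auto
  also have "\<dots> = 1 / real n ^ 3"
    using n_ge_2 by (simp add: field_simps power_add[symmetric])
  also have "\<dots> \<le> 1 / 2 ^ 3"
    using n_ge_2 by (intro divide_left_mono power_mono) auto
  finally have 1: "(real n)\<^sup>2 * (1 - real n / (2 * N)) ^ s \<le> 1 / 8"
    by simp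
  have "(1 - 2 * real f / N) ^ s \<le> exp (- (2 * real f / N * (2 * N / real f)))"
    using N_ge by (intro pow_le) (auto simp: field_simps)
  also have "2 * real f / N * (2 * N / real f) = 4"
    using N_ge f_ge_1 by simp
  also have "exp (- 4) = 1 / exp (1 :: real) ^ 4"
    by (simp add: exp_minus exp_of_nat_mult[symmetric] divide_inverse)
  also have "\<dots> \<le> 1 / 2 ^ 4"
    using exp_ge_add_one_self[of 1] by (intro divide_left_mono power_mono) auto
  finally have 2: "(1 - 2 * real f / N) ^ s \<le> 1 / 16"
    by simp
  have "rt_dist n matrix (s + s) \<le> \<epsilon>"
    using rt_dist_le[of s s] 1 2 assms(2) by linarith
  then have "rt_mixing_time n matrix \<epsilon> \<le> s + s"
    unfolding rt_mixing_time_def by (rule Least_le)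
  moreover have "real s \<le> 2 * N / real f + 1"
  proof -
    have "0 \<le> 2 * N / real f"
      using N_ge by simp
    then show ?thesis
      unfolding s_def using of_int_ceiling_le_add_one[of "2 * N / real f"] by simp
  qed
  moreover have "1 \<le> N / real f"
    using N_ge f_ge_1 by (simp add: field_simps)
  ultimately show ?thesis
    by simp
qed

lemma degree_eq_card_moves:
  "real n + 2 * real_of_int (graph_degree n (\<lambda>i. if i \<le> f then 1 else 2)) = N"
proof -
  have "(\<Sum>i=1..n. int (if i \<le> f then 1 else 2)) = (\<Sum>i=1..n. 2 - of_bool (i \<le> f))"
    by (intro sum.cong refl) auto
  also have "\<dots> = 2 * int n - (\<Sum>i=1..n. of_bool (i \<le> f))"
    by (simp add: sum_subtractf del: sum_of_bool_eq)
  also have "(\<Sum>i=1..n. of_bool (i \<le> f)) = (\<Sum>i=1..f. 1 :: int)"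
    using f_le_n by (intro sum.mono_neutral_cong_right) auto
  finally have "graph_degree n (\<lambda>i. if i \<le> f then 1 else 2) = (\<Sum>i=1..n. int i) - 2 * int n + int f"
    unfolding graph_degree_def sum_subtractf by simp
  moreover have "2 * (\<Sum>i=1..n. int i) = int n * (int n + 1)"
    by (induction n) (auto simp: algebra_simps)
  ultimately have "int n + 2 * graph_degree n (\<lambda>i. if i \<le> f then 1 else 2)
      = (int n)\<^sup>2 - 2 * int n + 2 * int f"
    by (simp add: power2_eq_square algebra_simps)
  then have "real_of_int (int n + 2 * graph_degree n (\<lambda>i. if i \<le> f then 1 else 2))
      = real_of_int ((int n)\<^sup>2 - 2 * int n + 2 * int f)"
    by (rule arg_cong)
  then show ?thesis
    by (simp add: N_def)
qed

end

theorem theorem2p14: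
  fixes f g :: "nat \<Rightarrow> nat"
    and b :: "nat \<Rightarrow> nat \<Rightarrow> nat"
    and M :: "nat \<Rightarrow> nat \<Rightarrow> nat \<Rightarrow> nat"
    and \<Delta> :: "nat \<Rightarrow> int"
  assumes g: "\<And>n. n \<ge> 1 \<Longrightarrow> g n = 1"
    and f_pos: "\<And>n. n \<ge> 1 \<Longrightarrow> f n \<ge> 1"
    and f_lim: "filterlim f at_top sequentially"
    and f_le: "\<forall>\<^sub>F n in sequentially. real (f n) \<le> real n / (5 * ln (real n))"
  defines "b \<equiv> two_step_vec f g"
    and "M \<equiv> \<lambda>n. one_sided_matrix (b n)"
    and "\<Delta> \<equiv> \<lambda>n. graph_degree n (b n)"
  shows "(\<exists>a A :: real. 0 < a \<and> a < A \<and>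
           (\<forall>\<^sub>F n in sequentially.
              a * ((real n + 2 * real_of_int (\<Delta> n)) / real (f n))
                \<le> real (rt_mixing_time n (M n) (1/4)) \<and>
              real (rt_mixing_time n (M n) (1/4))
                \<le> A * ((real n + 2 * real_of_int (\<Delta> n)) / real (f n))))
       \<and> \<not> rt_tv_cutoff M"
proof -
  have M_eq: "M n = hole_walk.matrix (f n)" and \<Delta>_eq: "real n + 2 * real_of_int (\<Delta> n) = hole_walk.N n (f n)"
    if "hole_walk n (f n)" for n
  proof -
    interpret hole_walk n "f n" by (fact that)
    have b: "b n = (\<lambda>i. if i \<le> f n then 1 else 2)"
      using g[of n] n_ge_2 by (simp add: b_def two_step_vec_def fun_eq_iff)
    show "M n = matrix"
      by (simp add: M_def b matrix_def)
    show "real n + 2 * real_of_int (\<Delta> n) = N"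
      unfolding \<Delta>_def b by (rule degree_eq_card_moves)
  qed
  have good: "\<forall>\<^sub>F n in sequentially. hole_walk n (f n) \<and> 2 \<le> f n
      \<and> 4 * real (f n) \<le> hole_walk.N n (f n) \<and> real (f n) \<le> real n / (5 * ln (real n))"
    using f_le eventually_ge_at_top[of 3] f_lim[unfolded filterlim_at_top, rule_format, of 2]
  proof eventually_elim
    case (elim n)
    have "1 \<le> ln (real n)"
      using elim(2) exp_le by (subst ln_ge_iff) auto
    then have "real n / (5 * ln (real n)) \<le> real n / 5"
      by (intro divide_left_mono) auto
    then have f5: "5 * real (f n) \<le> real n"
      using elim(1) by linarith
    then interpret hole_walk n "f n"
      using elim by unfold_locales linarith+
    have "real n * 1 \<le> real n * (real n - 2)"
      using elim(2) by (intro mult_left_mono) auto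
    then have "4 * real (f n) \<le> N"
      using f5 by (simp add: N_def power2_eq_square algebra_simps)
    then show ?case
      using elim hole_walk_axioms by simp
  qed
  have lower: "ln (1 / (2 * \<epsilon>)) / 4 * ((real n + 2 * real_of_int (\<Delta> n)) / real (f n))
      \<le> real (rt_mixing_time n (M n) \<epsilon>)"
    if "0 < \<epsilon>" "hole_walk n (f n)" "2 \<le> f n" "4 * real (f n) \<le> hole_walk.N n (f n)" for n \<epsilon>
    using hole_walk.mixing_time_ge[OF that(2,3,4,1)] M_eq[OF that(2)] \<Delta>_eq[OF that(2)] by simp
  have upper: "real (rt_mixing_time n (M n) \<epsilon>)
      \<le> 6 * ((real n + 2 * real_of_int (\<Delta> n)) / real (f n))"
    if "1 / 4 \<le> \<epsilon>" "hole_walk n (f n)" "real (f n) \<le> real n / (5 * ln (real n))" for n \<epsilon>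
    using hole_walk.mixing_time_le[OF that(2,3,1)] M_eq[OF that(2)] \<Delta>_eq[OF that(2)] by simp
  show ?thesis
  proof (intro conjI exI)
    show "0 < ln 2 / (4 :: real)" "ln 2 / 4 < (6 :: real)"
      using ln_2_less_1 by auto
    show "\<forall>\<^sub>F n in sequentially.
        ln 2 / 4 * ((real n + 2 * real_of_int (\<Delta> n)) / real (f n))
          \<le> real (rt_mixing_time n (M n) (1/4))
        \<and> real (rt_mixing_time n (M n) (1/4))
          \<le> 6 * ((real n + 2 * real_of_int (\<Delta> n)) / real (f n))"
      using good
    proof eventually_elim
      case (elim n)
      then show ?case
        using lower[of "1/4" n] upper[of "1/4" n] by simp
    qed
    show "\<not> rt_tv_cutoff M"
    proof
      assume cutoff: "rt_tv_cutoff M"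
      \<comment> \<open>chosen such that \<open>ln (1 / (2 \<epsilon>)) / 4 = 12\<close>, twice the constant of the upper bound\<close>
      define \<epsilon> :: real where "\<epsilon> = exp (- 48) / 2"
      have \<epsilon>: "0 < \<epsilon>" "\<epsilon> \<le> 1 / 2"
        by (auto simp: \<epsilon>_def)
      have ln_\<epsilon>: "ln (1 / (2 * \<epsilon>)) = 48"
        by (simp add: \<epsilon>_def ln_div)
      let ?r = "\<lambda>n. real (rt_mixing_time n (M n) \<epsilon>) / real (rt_mixing_time n (M n) (1 - \<epsilon>))"
      have "?r \<longlonglongrightarrow> 1"
        using cutoff \<epsilon> by (simp add: rt_tv_cutoff_def)
      then have "\<forall>\<^sub>F n in sequentially. 0 < ?r n" "\<forall>\<^sub>F n in sequentially. ?r n < 2"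
        by (auto intro: order_tendstoD)
      with good have "\<forall>\<^sub>F n :: nat in sequentially. False"
      proof eventually_elim
        case (elim n)
        define q where "q = (real n + 2 * real_of_int (\<Delta> n)) / real (f n)"
        \<comment> \<open>A mixing time \<open>0\<close> in the denominator would make the ratio \<open>0\<close>, so positivity of the ratio is used too.\<close>
        have "12 * q \<le> real (rt_mixing_time n (M n) \<epsilon>)"
          using lower[of \<epsilon> n] elim \<epsilon> ln_\<epsilon> by (simp add: q_def)
        moreover have "real (rt_mixing_time n (M n) (1 - \<epsilon>)) \<le> 6 * q"
          using upper[of "1 - \<epsilon>" n] elim \<epsilon> by (simp add: q_def)
        moreover have "0 < real (rt_mixing_time n (M n) (1 - \<epsilon>))"
          using elim(2) by (cases "rt_mixing_time n (M n) (1 - \<epsilon>) = 0") auto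
        ultimately show False
          using elim(3) by (simp add: field_simps)
      qed
      then show False
        by simp
    qed
  qed
qed

end
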